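(* Let $m>n$, let $k$ be a positive integer and let $\epsilon>0$. Suppose $\Phi = [\epsilon A + \Delta_r]N\in\mathbb{R}^{n\times m}$, where the elements of $A\in\mathbb{R}^{n\times m}$ are drawn iid from the Gaussian distribution with mean $0$ and standard deviation $1/\sqrt{n}$, $\Delta_r\in\mathbb{R}^{n\times m}$ is any arbitrary fixed matrix with $\mathrm{rank}[\Delta_r]=r<n$, and $N$ is the diagonal matrix that scales the columns so that $\Phi$ has unit $\ell_2$ column norms. Then $$\mathbb{E}\left(\delta^*_{3k}[\Phi]\right)\le \mathbb{E}\left(\delta_{3k}[\widetilde{A}]\right),$$ where $\widetilde{A}$ denotes the matrix $A$ with any $r$ rows removed.
   Context: $\|x\|_0$ denotes the number of nonzero entries of $x$. For a matrix $M$ with $m$ columns, the restricted isometry constant $\delta_s[M]$ is the smallest $\delta\ge 0$ such that $(1-\delta)\|x\|_2^2\le\|Mx\|_2^2\le(1+\delta)\|x\|_2^2$ for all $x\in\mathbb{R}^m$ with $\|x\|_0\le s$. For $\Phi\in\mathbb{R}^{n\times m}$, $\delta^*_{3k}[\Phi]\triangleq\inf_{W,D}\delta_{3k}[W\Phi D]$, where $W$ ranges over all real matrices with $n$ columns (any number of rows) and $D$ over all full-rank (invertible) diagonal $m\times m$ matrices. Expectations are over the random matrix $A$. *)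

theory Defs
  imports
    "HOL-Probability.Probability"
    "Jordan_Normal_Form.DL_Rank"
    "Jordan_Normal_Form.DL_Submatrix"
begin

definition vec_l0 :: "real Matrix.vec \<Rightarrow> nat" where
  "vec_l0 x = card {i. i < dim_vec x \<and> vec_index x i \<noteq> 0}"

definition vec_l2 :: "real Matrix.vec \<Rightarrow> real" where
  "vec_l2 x = L2_set (vec_index x) {..<dim_vec x}"

definition is_rip_bound :: "nat \<Rightarrow> real mat \<Rightarrow> real \<Rightarrow> bool" where
  "is_rip_bound s M \<delta> \<longleftrightarrow> 0 \<le> \<delta> \<and>
     (\<forall>x \<in> carrier_vec (dim_col M). vec_l0 x \<le> s \<longrightarrow>
        (1 - \<delta>) * (vec_l2 x)\<^sup>2 \<le> (vec_l2 (M *\<^sub>v x))\<^sup>2 \<and>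
        (vec_l2 (M *\<^sub>v x))\<^sup>2 \<le> (1 + \<delta>) * (vec_l2 x)\<^sup>2)"

definition ric :: "nat \<Rightarrow> real mat \<Rightarrow> real" where
  "ric s M = (LEAST \<delta>. is_rip_bound s M \<delta>)"

definition ric_opt :: "nat \<Rightarrow> real mat \<Rightarrow> real" where
  "ric_opt s \<Phi> = Inf {ric s (W * \<Phi> * D) | W D.
     dim_col W = dim_row \<Phi> \<and>
     D \<in> carrier_mat (dim_col \<Phi>) (dim_col \<Phi>) \<and> diagonal_mat D \<and> invertible_mat D}"

text \<open>A zero column gets the factor \<open>1 / 0 = 0\<close> and stays zero. For a fixed matrix plus a nonzero
  multiple of a Gaussian one this happens with probability zero.\<close>

definition col_scaling :: "real mat \<Rightarrow> real mat" where
  "col_scaling B = mat_diag (dim_col B) (\<lambda>j. 1 / vec_l2 (col B j))"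

definition normalize_cols :: "real mat \<Rightarrow> real mat" where
  "normalize_cols B = B * col_scaling B"

definition remove_rows :: "nat set \<Rightarrow> 'a mat \<Rightarrow> 'a mat" where
  "remove_rows R B = submatrix B (- R) UNIV"

lemma vec_l2_sq: "(vec_l2 x)\<^sup>2 = (\<Sum>i<dim_vec x. (vec_index x i)\<^sup>2)"
  by (simp add: vec_l2_def L2_set_def sum_nonneg)

lemma mult_mat_vec_bound:
  assumes "x \<in> carrier_vec (dim_col M)"
  shows "(vec_l2 (M *\<^sub>v x))\<^sup>2
    \<le> (\<Sum>i<dim_row M. \<Sum>j<dim_col M. (M $$ (i, j))\<^sup>2) * (vec_l2 x)\<^sup>2"
proof -
  have d: "dim_vec x = dim_col M" using assms by auto
  have "(vec_l2 (M *\<^sub>v x))\<^sup>2 = (\<Sum>i<dim_row M. (\<Sum>j<dim_col M. M $$ (i, j) * vec_index x j)\<^sup>2)"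
    using d by (simp add: vec_l2_sq scalar_prod_def row_def atLeast0LessThan)
  also have "\<dots> \<le> (\<Sum>i<dim_row M. (\<Sum>j<dim_col M. (M $$ (i, j))\<^sup>2) * (\<Sum>j<dim_col M. (vec_index x j)\<^sup>2))"
    by (intro sum_mono Cauchy_Schwarz_ineq_sum)
  finally show ?thesis using d by (simp add: vec_l2_sq sum_distrib_right)
qed

lemma is_rip_bound_ric: "is_rip_bound s M (ric s M)"
  and ric_le: "is_rip_bound s M \<delta> \<Longrightarrow> ric s M \<le> \<delta>"
proof -
  let ?S = "{\<delta>. is_rip_bound s M \<delta>}"
  have eq: "?S = {0..} \<inter> (\<Inter>x\<in>{x \<in> carrier_vec (dim_col M). vec_l0 x \<le> s}.
      {\<delta>. (1 - \<delta>) * (vec_l2 x)\<^sup>2 \<le> (vec_l2 (M *\<^sub>v x))\<^sup>2} \<inter>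
      {\<delta>. (vec_l2 (M *\<^sub>v x))\<^sup>2 \<le> (1 + \<delta>) * (vec_l2 x)\<^sup>2})"
    by (auto simp: is_rip_bound_def)
  have cl: "closed ?S"
    unfolding eq by (intro closed_Int closed_INT ballI closed_Collect_le continuous_intros closed_atLeast)
  define c where "c = (\<Sum>i<dim_row M. \<Sum>j<dim_col M. (M $$ (i, j))\<^sup>2)"
  have c0: "0 \<le> c" unfolding c_def by (intro sum_nonneg) auto
  have "is_rip_bound s M (c + 1)"
    unfolding is_rip_bound_def
  proof (intro conjI ballI impI)
    fix x :: "real Matrix.vec" assume x: "x \<in> carrier_vec (dim_col M)"
    have "(1 - (c + 1)) * (vec_l2 x)\<^sup>2 \<le> 0"
      using c0 by (simp add: mult_nonneg_nonneg)
    then show "(1 - (c + 1)) * (vec_l2 x)\<^sup>2 \<le> (vec_l2 (M *\<^sub>v x))\<^sup>2"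
      by (rule order_trans) simp
    have "c * (vec_l2 x)\<^sup>2 \<le> (1 + (c + 1)) * (vec_l2 x)\<^sup>2"
      by (intro mult_right_mono) auto
    with mult_mat_vec_bound[OF x]
    show "(vec_l2 (M *\<^sub>v x))\<^sup>2 \<le> (1 + (c + 1)) * (vec_l2 x)\<^sup>2"
      unfolding c_def[symmetric] by linarith
  qed (use c0 in simp)
  then have ne: "?S \<noteq> {}" by auto
  have bb: "bdd_below ?S" by (rule bdd_belowI[of _ 0]) (simp add: is_rip_bound_def)
  have i: "is_rip_bound s M (Inf ?S)"
    using closed_contains_Inf[OF ne bb cl] by simp
  have l: "Inf ?S \<le> \<delta>" if "is_rip_bound s M \<delta>" for \<delta>
    using that bb by (intro cInf_lower) auto
  have "ric s M = Inf ?S" unfolding ric_def by (rule Least_equality) (use i l in auto)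
  then show "is_rip_bound s M (ric s M)" "is_rip_bound s M \<delta> \<Longrightarrow> ric s M \<le> \<delta>"
    using i l by auto
qed

end

theory Submission
  imports Defs
begin

text \<open>
  Choose \<open>W\<close> with \<open>n - r\<close> orthonormal rows in the left null space of \<open>\<Delta>\<close>. With the row transformation
  \<open>W / \<epsilon>\<close> and with a diagonal matrix that undoes the column normalization, \<open>\<Phi>\<close> becomes \<open>W * A\<close>, so that
  pointwise the optimal constant is at most the constant of \<open>W * A\<close>. Removing rows of \<open>A\<close> is
  multiplication by another matrix with orthonormal rows. Orthonormal linear functionals of
  an i.i.d. centred Gaussian family are again such a family, hence \<open>W * A\<close> and the row-reduced \<open>A\<close> have
  the same law, and the same expected constant.

  The statement about Gaussian families is proved by induction on the number of functionals: Givens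
  rotations turn one functional into a coordinate up to sign, and by orthogonality the remaining
  functionals do not involve that coordinate.
\<close>

section \<open>Gaussian families\<close>

abbreviation gaussian :: "real \<Rightarrow> real measure" where
  "gaussian \<sigma> \<equiv> density lborel (\<lambda>x. ennreal (normal_density 0 \<sigma> x))"

section \<open>Rotation invariance in the plane\<close>

text \<open>For \<open>c \<noteq> 0\<close> a rotation factors into two affine substitutions, each
  changing one variable: first \<open>v\<close> becomes \<open>(v - s * u) / c\<close> with
  \<open>u\<close> fixed, then \<open>u\<close> becomes \<open>c * u + s * v\<close> with
  \<open>v\<close> fixed. With Fubini in between, the Jacobian factors
  \<open>\<bar>1 / c\<bar>\<close> and \<open>\<bar>c\<bar>\<close> cancel.\<close>

lemma nn_integral_lborel_rotation:
  fixes h :: "real \<times> real \<Rightarrow> ennreal"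
  assumes [measurable]: "h \<in> borel_measurable (borel \<Otimes>\<^sub>M borel)"
    and cs: "c\<^sup>2 + s\<^sup>2 = 1" and c: "c \<noteq> 0"
  shows "(\<integral>\<^sup>+v. \<integral>\<^sup>+u. h (c * u + s * v, c * v - s * u) \<partial>lborel \<partial>lborel)
    = (\<integral>\<^sup>+v. \<integral>\<^sup>+u. h (u, v) \<partial>lborel \<partial>lborel)"
proof -
  have aux: "c * v - s * u = (v - s * (c * u + s * v)) / c" for u v
  proof -
    have "v = (c\<^sup>2 + s\<^sup>2) * v" using cs by simp
    then show ?thesis using c by (simp add: field_simps power2_eq_square)
  qed
  have "(\<integral>\<^sup>+v. \<integral>\<^sup>+u. h (u, v) \<partial>lborel \<partial>lborel) = (\<integral>\<^sup>+u. \<integral>\<^sup>+v. h (u, v) \<partial>lborel \<partial>lborel)"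
    by (rule lborel_pair.Fubini') simp
  also have "\<dots> = (\<integral>\<^sup>+u. ennreal \<bar>1 / c\<bar> * (\<integral>\<^sup>+v. h (u, - (s * u / c) + 1 / c * v) \<partial>lborel) \<partial>lborel)"
    by (intro nn_integral_cong nn_integral_real_affine) (use c in simp_all)
  also have "\<dots> = ennreal \<bar>1 / c\<bar> * (\<integral>\<^sup>+u. \<integral>\<^sup>+v. h (u, (v - s * u) / c) \<partial>lborel \<partial>lborel)"
    by (subst nn_integral_cmult[symmetric]) (auto simp: diff_divide_distrib)
  also have "(\<integral>\<^sup>+u. \<integral>\<^sup>+v. h (u, (v - s * u) / c) \<partial>lborel \<partial>lborel)
      = (\<integral>\<^sup>+v. \<integral>\<^sup>+u. h (u, (v - s * u) / c) \<partial>lborel \<partial>lborel)"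
    by (rule lborel_pair.Fubini'[symmetric]) simp
  also have "\<dots> = (\<integral>\<^sup>+v. ennreal \<bar>c\<bar> * (\<integral>\<^sup>+u. h (s * v + c * u, (v - s * (s * v + c * u)) / c) \<partial>lborel) \<partial>lborel)"
    by (intro nn_integral_cong nn_integral_real_affine) (use c in simp_all)
  also have "\<dots> = ennreal \<bar>c\<bar> * (\<integral>\<^sup>+v. \<integral>\<^sup>+u. h (c * u + s * v, c * v - s * u) \<partial>lborel \<partial>lborel)"
    by (subst nn_integral_cmult[symmetric]) (auto simp: aux add.commute)
  finally show ?thesis
    using c by (simp add: mult.assoc[symmetric] ennreal_mult[symmetric])
qed

text \<open>The product of the two densities depends on the point only through its distance from the
  origin, which a rotation preserves. The weight can therefore be absorbed into the integrand of the
  Lebesgue version.\<close>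

lemma nn_integral_gaussian_rotation:
  fixes g :: "real \<times> real \<Rightarrow> ennreal"
  assumes [measurable]: "g \<in> borel_measurable (borel \<Otimes>\<^sub>M borel)"
    and cs: "c\<^sup>2 + s\<^sup>2 = 1" and c: "c \<noteq> 0"
  shows "(\<integral>\<^sup>+v. \<integral>\<^sup>+u. g (c * u + s * v, c * v - s * u) \<partial>gaussian \<sigma> \<partial>gaussian \<sigma>)
    = (\<integral>\<^sup>+v. \<integral>\<^sup>+u. g (u, v) \<partial>gaussian \<sigma> \<partial>gaussian \<sigma>)"
proof -
  define h where "h = (\<lambda>(u, v). ennreal (normal_density 0 \<sigma> v) * (ennreal (normal_density 0 \<sigma> u) * g (u, v)))"
  have h[measurable]: "h \<in> borel_measurable (borel \<Otimes>\<^sub>M borel)" unfolding h_def by measurable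
  have aux: "- p / t + - q / t = - v / t + - w / t" if "p + q = v + w" for p q v w t :: real
  proof -
    have "- p / t + - q / t = - (p + q) / t" "- v / t + - w / t = - (v + w) / t"
      by (simp_all add: add_divide_distrib diff_divide_distrib)
    then show ?thesis using that by simp
  qed
  have d: "normal_density 0 \<sigma> (c * v - s * u) * normal_density 0 \<sigma> (c * u + s * v)
      = normal_density 0 \<sigma> v * normal_density 0 \<sigma> u" for u v
  proof -
    have "(c * v - s * u)\<^sup>2 + (c * u + s * v)\<^sup>2 = (c\<^sup>2 + s\<^sup>2) * (v\<^sup>2 + u\<^sup>2)"
      by (simp add: power2_eq_square algebra_simps)
    then have "- (c * v - s * u)\<^sup>2 / (2 * \<sigma>\<^sup>2) + - (c * u + s * v)\<^sup>2 / (2 * \<sigma>\<^sup>2)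
        = - v\<^sup>2 / (2 * \<sigma>\<^sup>2) + - u\<^sup>2 / (2 * \<sigma>\<^sup>2)"
      using cs by (intro aux) simp
    then have "exp (- (c * v - s * u)\<^sup>2 / (2 * \<sigma>\<^sup>2)) * exp (- (c * u + s * v)\<^sup>2 / (2 * \<sigma>\<^sup>2))
        = exp (- v\<^sup>2 / (2 * \<sigma>\<^sup>2)) * exp (- u\<^sup>2 / (2 * \<sigma>\<^sup>2))"
      by (simp only: exp_add[symmetric])
    then show ?thesis unfolding normal_density_def by simp
  qed
  have conv: "(\<integral>\<^sup>+v. \<integral>\<^sup>+u. k u v \<partial>gaussian \<sigma> \<partial>gaussian \<sigma>)
      = (\<integral>\<^sup>+v. \<integral>\<^sup>+u. ennreal (normal_density 0 \<sigma> v * normal_density 0 \<sigma> u) * k u v \<partial>lborel \<partial>lborel)"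
    if [measurable]: "case_prod k \<in> borel_measurable (borel \<Otimes>\<^sub>M borel)" for k
    by (simp add: nn_integral_density nn_integral_cmult[symmetric] ennreal_mult mult.assoc)
  show ?thesis
    using nn_integral_lborel_rotation[OF h cs c]
    by (subst (1 2) conv) (simp_all add: h_def mult.assoc[symmetric] ennreal_mult[symmetric] d)
qed

text \<open>The centred density is even. This absorbs the sign left over when a unit functional has
  been reduced to a single coordinate.\<close>

lemma nn_integral_gaussian_uminus:
  fixes f :: "real \<Rightarrow> ennreal"
  assumes [measurable]: "f \<in> borel_measurable borel"
  shows "(\<integral>\<^sup>+x. f (- x) \<partial>gaussian \<sigma>) = (\<integral>\<^sup>+x. f x \<partial>gaussian \<sigma>)"
proof -
  have "(\<integral>\<^sup>+x. f x \<partial>gaussian \<sigma>) = (\<integral>\<^sup>+x. ennreal (normal_density 0 \<sigma> x) * f x \<partial>lborel)"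
    by (simp add: nn_integral_density)
  also have "\<dots> = (\<integral>\<^sup>+x. ennreal (normal_density 0 \<sigma> x) * f (- x) \<partial>lborel)"
    by (subst nn_integral_real_affine[of _ "-1" 0]) (simp_all add: normal_density_def)
  finally show ?thesis by (simp add: nn_integral_density)
qed

lemma emeasure_distr_nn_integral:
  assumes "f \<in> M \<rightarrow>\<^sub>M N" "B \<in> sets N"
  shows "emeasure (distr M N f) B = (\<integral>\<^sup>+x. indicator B (f x) \<partial>M)"
  using assms by (subst nn_integral_distr[symmetric]) auto

section \<open>Orthonormal functionals of a Gaussian family\<close>

lemma measurable_Givens [measurable]:
  assumes "a \<in> I" "b \<in> I"
  shows "(\<lambda>x. x(a := c * x a + s * x b, b := c * x b - s * x a))
    \<in> PiM I (\<lambda>_. gaussian \<sigma>) \<rightarrow>\<^sub>M PiM I (\<lambda>_. gaussian \<sigma>)"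
proof (rule measurable_PiM_single')
  fix i assume "i \<in> I"
  then show "(\<lambda>x. (x(a := c * x a + s * x b, b := c * x b - s * x a)) i)
      \<in> PiM I (\<lambda>_. gaussian \<sigma>) \<rightarrow>\<^sub>M gaussian \<sigma>"
    using assms by (cases "i = b"; cases "i = a") simp_all
next
  show "(\<lambda>x. x(a := c * x a + s * x b, b := c * x b - s * x a))
      \<in> space (PiM I (\<lambda>_. gaussian \<sigma>)) \<rightarrow> (\<Pi>\<^sub>E i\<in>I. space (gaussian \<sigma>))"
    using assms by (auto simp: space_PiM PiE_def extensional_def)
qed

text \<open>By Fubini the coordinates \<open>a\<close> and \<open>b\<close> are integrated first,
  with the remaining ones fixed. On this plane the map is a rotation, so the planar invariance
  applies to every slice.\<close>

lemma distr_gaussian_Givens: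
  assumes I: "finite I" and ab: "a \<in> I" "b \<in> I" "a \<noteq> b"
    and cs: "c\<^sup>2 + s\<^sup>2 = 1" and c: "c \<noteq> 0" and \<sigma>: "0 < \<sigma>"
  shows "distr (PiM I (\<lambda>_. gaussian \<sigma>)) (PiM I (\<lambda>_. gaussian \<sigma>))
      (\<lambda>x. x(a := c * x a + s * x b, b := c * x b - s * x a)) = PiM I (\<lambda>_. gaussian \<sigma>)"
    (is "distr ?P ?P ?T = _")
proof (rule measure_eqI)
  interpret N: prob_space "gaussian \<sigma>" using prob_space_normal_density[OF \<sigma>] .
  interpret product_sigma_finite "\<lambda>_. gaussian \<sigma>" by standard
  define K where "K = I - {a, b}"
  have K: "finite K" "b \<notin> K" "finite (insert b K)" "a \<notin> insert b K" "I = insert a (insert b K)"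
    using I ab by (auto simp: K_def)
  have iter: "(\<integral>\<^sup>+x. f x \<partial>?P) = (\<integral>\<^sup>+z. \<integral>\<^sup>+v. \<integral>\<^sup>+u. f (z(b := v, a := u)) \<partial>gaussian \<sigma> \<partial>gaussian \<sigma> \<partial>PiM K (\<lambda>_. gaussian \<sigma>))"
    if f[measurable]: "f \<in> borel_measurable ?P" for f
  proof -
    note f'[measurable] = f[unfolded K(5)]
    have "(\<integral>\<^sup>+x. f x \<partial>?P) = (\<integral>\<^sup>+x. \<integral>\<^sup>+u. f (x(a := u)) \<partial>gaussian \<sigma> \<partial>PiM (insert b K) (\<lambda>_. gaussian \<sigma>))"
      unfolding K(5) using K f' by (intro product_nn_integral_insert)
    also have "\<dots> = (\<integral>\<^sup>+z. \<integral>\<^sup>+v. \<integral>\<^sup>+u. f (z(b := v, a := u)) \<partial>gaussian \<sigma> \<partial>gaussian \<sigma> \<partial>PiM K (\<lambda>_. gaussian \<sigma>))"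
      using K by (intro product_nn_integral_insert) measurable
    finally show ?thesis .
  qed
  fix B assume "B \<in> sets (distr ?P ?P ?T)"
  then have B[measurable]: "B \<in> sets ?P" by simp
  have T[measurable]: "?T \<in> ?P \<rightarrow>\<^sub>M ?P" using ab by measurable
  note B'[measurable] = B[unfolded K(5)]
  have "emeasure (distr ?P ?P ?T) B = (\<integral>\<^sup>+x. indicator B (?T x) \<partial>?P)"
    using T B by (rule emeasure_distr_nn_integral)
  also have "\<dots> = (\<integral>\<^sup>+z. \<integral>\<^sup>+v. \<integral>\<^sup>+u. indicator B (?T (z(b := v, a := u))) \<partial>gaussian \<sigma> \<partial>gaussian \<sigma> \<partial>PiM K (\<lambda>_. gaussian \<sigma>))"
    by (rule iter) measurable
  also have "\<dots> = (\<integral>\<^sup>+z. \<integral>\<^sup>+v. \<integral>\<^sup>+u. indicator B (z(b := v, a := u)) \<partial>gaussian \<sigma> \<partial>gaussian \<sigma> \<partial>PiM K (\<lambda>_. gaussian \<sigma>))"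
  proof (rule nn_integral_cong)
    fix z assume z[measurable]: "z \<in> space (PiM K (\<lambda>_. gaussian \<sigma>))"
    define g :: "real \<times> real \<Rightarrow> ennreal" where "g = (\<lambda>(u, v). indicator B (z(b := v, a := u)))"
    have "(\<lambda>w. z(b := snd w, a := fst w)) \<in> borel \<Otimes>\<^sub>M borel \<rightarrow>\<^sub>M PiM (insert a (insert b K)) (\<lambda>_. gaussian \<sigma>)"
      using z by (intro measurable_fun_upd[where J="insert b K"] measurable_fun_upd[where J=K]) auto
    then have g: "g \<in> borel_measurable (borel \<Otimes>\<^sub>M borel)"
      unfolding g_def split_beta' by measurable
    \<comment> \<open>The rotation leaves \<open>z\<close> alone and only changes the pair of
      inserted values, which is the form the planar lemma speaks about.\<close>
    have "?T (z(b := v, a := u)) = z(b := c * v - s * u, a := c * u + s * v)" for u v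
      using ab by (auto simp: fun_eq_iff)
    then show "(\<integral>\<^sup>+v. \<integral>\<^sup>+u. indicator B (?T (z(b := v, a := u))) \<partial>gaussian \<sigma> \<partial>gaussian \<sigma>)
        = (\<integral>\<^sup>+v. \<integral>\<^sup>+u. indicator B (z(b := v, a := u)) \<partial>gaussian \<sigma> \<partial>gaussian \<sigma>)"
      using nn_integral_gaussian_rotation[OF g cs c, of \<sigma>] by (simp add: g_def)
  qed
  also have "\<dots> = (\<integral>\<^sup>+x. indicator B x \<partial>?P)"
    by (rule iter[symmetric]) measurable
  finally show "emeasure (distr ?P ?P ?T) B = emeasure ?P B"
    by simp
qed simp


text \<open>\<open>I\<close> and \<open>u\<close> are generalized in the induction on
  \<open>J\<close>, because the step for \<open>j\<close> rotates all functionals and then deletes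
  one coordinate from \<open>I\<close>.\<close>

lemma distr_gaussian_orthonormal:
  fixes u :: "'j \<Rightarrow> 'i \<Rightarrow> real"
  assumes \<sigma>: "0 < \<sigma>" and "finite I" and "finite J"
    and "\<And>j j'. j \<in> J \<Longrightarrow> j' \<in> J \<Longrightarrow> (\<Sum>i\<in>I. u j i * u j' i) = (if j = j' then 1 else 0)"
  shows "distr (PiM I (\<lambda>_. gaussian \<sigma>)) (PiM J (\<lambda>_. gaussian \<sigma>))
      (\<lambda>x. \<lambda>j\<in>J. \<Sum>i\<in>I. u j i * x i) = PiM J (\<lambda>_. gaussian \<sigma>)"
  using assms(3,2,4)
proof (induction J arbitrary: I u rule: finite_induct)
  interpret N: prob_space "gaussian \<sigma>" using prob_space_normal_density[OF \<sigma>] .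
  interpret product_sigma_finite "\<lambda>_. gaussian \<sigma>" by standard
  have P: "prob_space (PiM I (\<lambda>_. gaussian \<sigma>))" for I :: "'i set"
    by (intro prob_space_PiM N.prob_space_axioms)
  {
    case (empty I u)
    \<comment> \<open>The empty product space has one point, so only the total mass 1 has to be
      compared.\<close>
    show ?case
    proof (rule PiM_eqI)
      fix A :: "'j \<Rightarrow> real set"
      let ?L = "\<lambda>x. \<lambda>j\<in>{}. \<Sum>i\<in>I. u j i * x i"
      have L: "?L \<in> PiM I (\<lambda>_. gaussian \<sigma>) \<rightarrow>\<^sub>M PiM {} (\<lambda>_. gaussian \<sigma>)"
        by (intro measurable_restrict) auto
      have A: "Pi\<^sub>E {} A \<in> sets (PiM {} (\<lambda>_. gaussian \<sigma>))"
        by (rule sets_PiM_I_finite) auto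
      have "?L -` Pi\<^sub>E {} A \<inter> space (PiM I (\<lambda>_. gaussian \<sigma>)) = space (PiM I (\<lambda>_. gaussian \<sigma>))"
        by auto
      then show "emeasure (distr (PiM I (\<lambda>_. gaussian \<sigma>)) (PiM {} (\<lambda>_. gaussian \<sigma>)) ?L) (Pi\<^sub>E {} A)
          = (\<Prod>i\<in>{}. emeasure (gaussian \<sigma>) (A i))"
        using prob_space.emeasure_space_1[OF P, of I] by (simp only: emeasure_distr[OF L A] prod.empty)
    qed simp_all
  next
    case (insert j J I u)
    have meas: "(\<lambda>x. \<lambda>j\<in>J'. \<Sum>i\<in>I'. w j i * x i) \<in> PiM I' (\<lambda>_. gaussian \<sigma>) \<rightarrow>\<^sub>M PiM J' (\<lambda>_. gaussian \<sigma>)"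
      for J' :: "'j set" and I' :: "'i set" and w
      by (intro measurable_restrict) simp
    have "\<exists>a\<in>I. u j a \<noteq> 0"
    proof (rule ccontr)
      assume "\<not> (\<exists>a\<in>I. u j a \<noteq> 0)"
      then have "(\<Sum>i\<in>I. u j i * u j i) = 0" by (intro sum.neutral) auto
      then show False using insert.prems(2)[of j j] by simp
    qed
    \<comment> \<open>The inner induction is on the number of nonzero entries of \<open>u j\<close>,
      for fixed \<open>I\<close>. That such an entry exists is carried along as a premise.\<close>
    then show ?case
      using insert.prems
    proof (induction "card {i \<in> I. u j i \<noteq> 0}" arbitrary: u rule: less_induct)
      case (less u)
      note orth = less.prems(3)
      obtain a where a: "a \<in> I" "u j a \<noteq> 0" using less.prems(1) by blast
      let ?L = "\<lambda>u x. \<lambda>j\<in>insert j J. \<Sum>i\<in>I. u j i * x i"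
      let ?P = "PiM I (\<lambda>_. gaussian \<sigma>)" and ?Q = "PiM (insert j J) (\<lambda>_. gaussian \<sigma>)"
      show ?case
      proof (cases "\<exists>b\<in>I. b \<noteq> a \<and> u j b \<noteq> 0")
        case True
        then obtain b where b: "b \<in> I" "b \<noteq> a" "u j b \<noteq> 0" by blast
        txt \<open>A Givens rotation in the plane of \<open>a\<close> and \<open>b\<close> preserves the Gaussian measure
          and makes entry \<open>b\<close> of the functional \<open>u j\<close> vanish.\<close>
        define \<rho> where "\<rho> = sqrt ((u j a)\<^sup>2 + (u j b)\<^sup>2)"
        define c where "c = u j a / \<rho>"
        define s where "s = - u j b / \<rho>"
        have \<rho>: "0 < \<rho>" "\<rho>\<^sup>2 = (u j a)\<^sup>2 + (u j b)\<^sup>2"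
          using a b by (auto simp: \<rho>_def sum_power2_gt_zero_iff add_nonneg_nonneg)
        have cs: "c\<^sup>2 + s\<^sup>2 = 1"
          using \<rho> a by (simp add: c_def s_def power_divide add_divide_distrib[symmetric])
        \<comment> \<open>The pivot \<open>a\<close> was chosen in the support of
          \<open>u j\<close>; this supplies the side condition of the rotation lemma.\<close>
        have c0: "c \<noteq> 0" using a \<rho> by (simp add: c_def)
        \<comment> \<open>\<open>w k\<close> is the coefficient vector of \<open>u k\<close>
          precomposed with the rotation, that is, the transposed rotation applied to
          \<open>u k\<close>. All functionals are transformed at once, so inner products are
          preserved.\<close>
        define w where "w = (\<lambda>j. (u j)(a := c * u j a - s * u j b, b := s * u j a + c * u j b))"
        have wb: "w j b = 0" and wa: "w j a \<noteq> 0"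
        proof -
          show "w j b = 0" by (simp add: w_def c_def s_def)
          have "w j a = ((u j a)\<^sup>2 + (u j b)\<^sup>2) / \<rho>"
            using b(2) by (simp add: w_def c_def s_def power2_eq_square add_divide_distrib)
          then have "w j a = \<rho>\<^sup>2 / \<rho>" by (simp only: \<rho>(2))
          then show "w j a \<noteq> 0" using \<rho>(1) by simp
        qed
        have split: "(\<Sum>i\<in>I. f i) = f a + f b + (\<Sum>i\<in>I - {a, b}. f i)" for f :: "'i \<Rightarrow> real"
        proof -
          have "(\<Sum>i\<in>I. f i) = f a + (\<Sum>i\<in>I - {a}. f i)" using a less.prems(2) by (simp add: sum.remove)
          also have "(\<Sum>i\<in>I - {a}. f i) = f b + (\<Sum>i\<in>I - {a} - {b}. f i)"
            using b less.prems(2) by (intro sum.remove) auto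
          finally show ?thesis by (simp add: Diff_insert2[symmetric] insert_commute add.assoc)
        qed
        have rot: "(c * p - s * q) * (c * p' - s * q') + (s * p + c * q) * (s * p' + c * q') = p * p' + q * q'"
          for p q p' q' :: real
        proof -
          have "(c * p - s * q) * (c * p' - s * q') + (s * p + c * q) * (s * p' + c * q')
            = (c\<^sup>2 + s\<^sup>2) * (p * p' + q * q')" by (simp add: power2_eq_square algebra_simps)
          then show ?thesis by (simp add: cs)
        qed
        have orth': "(\<Sum>i\<in>I. w k i * w l i) = (\<Sum>i\<in>I. u k i * u l i)" for k l
        proof -
          have "(\<Sum>i\<in>I - {a, b}. w k i * w l i) = (\<Sum>i\<in>I - {a, b}. u k i * u l i)"
            by (intro sum.cong) (auto simp: w_def)
          moreover have "w k a * w l a + w k b * w l b = u k a * u l a + u k b * u l b"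
            using rot[of "u k a" "u k b" "u l a" "u l b"] b(2) by (simp add: w_def)
          ultimately show ?thesis by (simp only: split)
        qed
        \<comment> \<open>Entry \<open>b\<close> vanishes, entry \<open>a\<close> was already in the
          support, and all other entries are unchanged, so the support shrinks strictly.\<close>
        have "card {i \<in> I. w j i \<noteq> 0} < card {i \<in> I. u j i \<noteq> 0}"
        proof (rule psubset_card_mono)
          show "{i \<in> I. w j i \<noteq> 0} \<subset> {i \<in> I. u j i \<noteq> 0}"
            using a b wb by (auto simp: w_def split: if_splits)
        qed (use less.prems(2) in simp)
        then have IH: "distr ?P ?Q (?L w) = ?Q"
          by (rule less.hyps) (use wa a(1) less.prems(2) orth in \<open>auto simp: orth'\<close>)
        let ?T = "\<lambda>x. x(a := c * x a + s * x b, b := c * x b - s * x a)"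
        have "?L u (?T x) = ?L w x" for x
        proof (rule restrict_ext)
          fix k
          have "(\<Sum>i\<in>I - {a, b}. u k i * ?T x i) = (\<Sum>i\<in>I - {a, b}. w k i * x i)"
            by (intro sum.cong) (auto simp: w_def)
          moreover have "u k a * ?T x a + u k b * ?T x b = w k a * x a + w k b * x b"
            using b(2) by (simp add: w_def algebra_simps)
          ultimately show "(\<Sum>i\<in>I. u k i * ?T x i) = (\<Sum>i\<in>I. w k i * x i)"
            by (simp only: split)
        qed
        then have "?L u \<circ> ?T = ?L w" by (simp add: fun_eq_iff)
        \<comment> \<open>The induction hypothesis concerns \<open>w\<close>. Since
          \<open>?L w\<close> is \<open>?L u\<close> after a rotation that preserves
          \<open>?P\<close>, both have the same law.\<close>
        then have "distr ?P ?Q (?L w) = distr (distr ?P ?P ?T) ?Q (?L u)"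
          using meas measurable_Givens[OF a(1) b(1)] by (subst distr_distr) auto
        also have "distr ?P ?P ?T = ?P"
          using distr_gaussian_Givens[OF less.prems(2) a(1) b(1) b(2)[symmetric] cs c0 \<sigma>] .
        finally have "distr ?P ?Q (?L w) = distr ?P ?Q (?L u)" .
        from this[symmetric] IH show ?thesis by (rule trans)
      next
        case False
        then have u0: "u j i = 0" if "i \<in> I - {a}" for i using that by auto
        have split: "(\<Sum>i\<in>I. f i) = f a + (\<Sum>i\<in>I - {a}. f i)" for f :: "'i \<Rightarrow> real"
          using a less.prems(2) by (simp add: sum.remove)
        \<comment> \<open>\<open>u j\<close> is now supported on \<open>a\<close> alone: its norm
          forces the entry to be 1 or -1, and orthogonality to it makes every other functional
          vanish at \<open>a\<close>.\<close>
        have one: "u j a * u j a = 1"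
          using orth[of j j] by (simp add: split u0)
        then have e: "u j a = 1 \<or> u j a = - 1" by (simp add: square_eq_1_iff)
        have ua: "u k a = 0" if "k \<in> J" for k
        proof -
          have "j \<noteq> k" using that insert.hyps by blast
          then show ?thesis using orth[of j k] that a by (simp add: split u0)
        qed
        have orth': "(\<Sum>i\<in>I - {a}. u k i * u l i) = (if k = l then 1 else 0)" if "k \<in> J" "l \<in> J" for k l
          using orth[of k l] that by (simp add: split ua)
        let ?P' = "PiM (I - {a}) (\<lambda>_. gaussian \<sigma>)" and ?Q' = "PiM J (\<lambda>_. gaussian \<sigma>)"
        let ?L' = "\<lambda>x. \<lambda>j\<in>J. \<Sum>i\<in>I - {a}. u j i * x i"
        have IH: "distr ?P' ?Q' ?L' = ?Q'"
          using orth' less.prems(2) by (intro insert.IH) auto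
        have I: "insert a (I - {a}) = I" using a by auto
        have fin: "finite (I - {a})" using less.prems(2) by simp
        have upd: "?L u (x(a := y)) = (?L' x)(j := u j a * y)" for x y
          using insert.hyps(2) by (auto simp: fun_eq_iff split u0 ua)
        show ?thesis
        proof (rule measure_eqI)
          fix B assume "B \<in> sets (distr ?P ?Q (?L u))"
          then have B[measurable]: "B \<in> sets ?Q" by simp
          have L[measurable]: "?L u \<in> ?P \<rightarrow>\<^sub>M ?Q" and L'[measurable]: "?L' \<in> ?P' \<rightarrow>\<^sub>M ?Q'" by (rule meas)+
          \<comment> \<open>\<open>f y\<close> is the mass of the slice of \<open>B\<close> on which
            coordinate \<open>j\<close> equals \<open>y\<close>. Both measures of \<open>B\<close>
            become integrals of \<open>f\<close>, one of them with argument
            \<open>u j a * y\<close>, and evenness of the density removes the sign.\<close>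
          define f :: "_ \<Rightarrow> ennreal" where "f = (\<lambda>y. \<integral>\<^sup>+z. indicator B (z(j := y)) \<partial>?Q')"
          interpret Q': prob_space ?Q' by (intro prob_space_PiM N.prob_space_axioms)
          have updm: "(\<lambda>w. (snd w)(j := fst w)) \<in> borel \<Otimes>\<^sub>M ?Q' \<rightarrow>\<^sub>M ?Q"
            by (rule measurable_fun_upd[where J=J]) auto
          then have [measurable]: "(\<lambda>(y, z). indicator B (z(j := y)) :: ennreal) \<in> borel_measurable (borel \<Otimes>\<^sub>M ?Q')"
            unfolding split_beta' by measurable
          have updm1: "(\<lambda>z. z(j := y)) \<in> ?Q' \<rightarrow>\<^sub>M ?Q" for y
            by (rule measurable_fun_upd[where J=J]) auto
          have f: "f \<in> borel_measurable borel" unfolding f_def by measurable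
          have "emeasure (distr ?P ?Q (?L u)) B = (\<integral>\<^sup>+x. indicator B (?L u x) \<partial>?P)"
            using L B by (rule emeasure_distr_nn_integral)
          also have "\<dots> = (\<integral>\<^sup>+x. indicator B (?L u x) \<partial>PiM (insert a (I - {a})) (\<lambda>_. gaussian \<sigma>))"
            by (simp only: I)
          also have "\<dots> = (\<integral>\<^sup>+y. \<integral>\<^sup>+x. indicator B (?L u (x(a := y))) \<partial>?P' \<partial>gaussian \<sigma>)"
            by (rule product_nn_integral_insert_rev[OF fin]) (simp_all add: I)
          also have "\<dots> = (\<integral>\<^sup>+y. f (u j a * y) \<partial>gaussian \<sigma>)"
          proof (rule nn_integral_cong)
            fix y
            \<comment> \<open>The outer induction hypothesis is read backwards: \<open>?Q'\<close>
              is replaced by the law of \<open>?L'\<close>.\<close>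
            have "f (u j a * y) = (\<integral>\<^sup>+z. indicator B (z(j := u j a * y)) \<partial>distr ?P' ?Q' ?L')"
              unfolding f_def IH ..
            also have "\<dots> = (\<integral>\<^sup>+x. indicator B ((?L' x)(j := u j a * y)) \<partial>?P')"
              using updm1 by (intro nn_integral_distr L') simp
            finally show "(\<integral>\<^sup>+x. indicator B (?L u (x(a := y))) \<partial>?P') = f (u j a * y)"
              by (simp only: upd)
          qed
          also have "\<dots> = (\<integral>\<^sup>+y. f y \<partial>gaussian \<sigma>)"
            using e nn_integral_gaussian_uminus[OF f, of \<sigma>] by auto
          also have "\<dots> = (\<integral>\<^sup>+x. indicator B x \<partial>?Q)"
            unfolding f_def using insert.hyps
            by (intro product_nn_integral_insert_rev[symmetric]) auto
          finally show "emeasure (distr ?P ?Q (?L u)) B = emeasure ?Q B" by simp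
        qed simp
      qed
    qed
  }
qed

section \<open>Restricted isometry constants\<close>

text \<open>Multiplying out the squares and summing over the rows first collects the entries of
  \<open>M\<close> into inner products of columns, separated from \<open>x\<close>. Matrices with
  different numbers of rows become comparable in this way.\<close>

lemma vec_l2_mult_gram:
  assumes "x \<in> carrier_vec (dim_col M)"
  shows "(vec_l2 (M *\<^sub>v x))\<^sup>2 = (\<Sum>j<dim_col M. \<Sum>l<dim_col M.
    (\<Sum>i<dim_row M. M $$ (i, j) * M $$ (i, l)) * (vec_index x j * vec_index x l))"
proof -
  have d: "dim_vec x = dim_col M" using assms by auto
  have "(vec_l2 (M *\<^sub>v x))\<^sup>2 = (\<Sum>i<dim_row M. (\<Sum>j<dim_col M. M $$ (i, j) * vec_index x j)\<^sup>2)"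
    using d by (simp add: vec_l2_sq scalar_prod_def row_def atLeast0LessThan)
  also have "\<dots> = (\<Sum>i<dim_row M. \<Sum>j<dim_col M. \<Sum>l<dim_col M.
      M $$ (i, j) * M $$ (i, l) * (vec_index x j * vec_index x l))"
    by (simp add: power2_eq_square sum_product mult_ac)
  also have "\<dots> = (\<Sum>j<dim_col M. \<Sum>i<dim_row M. \<Sum>l<dim_col M.
      M $$ (i, j) * M $$ (i, l) * (vec_index x j * vec_index x l))"
    by (rule sum.swap)
  also have "\<dots> = (\<Sum>j<dim_col M. \<Sum>l<dim_col M. \<Sum>i<dim_row M.
      M $$ (i, j) * M $$ (i, l) * (vec_index x j * vec_index x l))"
    by (intro sum.cong refl sum.swap)
  finally show ?thesis by (simp add: sum_distrib_right)
qed

text \<open>The constant depends on the matrix only through its Gram matrix, and does so in a Lipschitz way.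
  This is the source of its continuity.\<close>

lemma ric_le_gram:
  assumes q: "dim_col M = q" "dim_col M' = q"
  shows "ric s M' \<le> ric s M + (\<Sum>j<q. \<Sum>l<q. \<bar>(\<Sum>i<dim_row M'. M' $$ (i, j) * M' $$ (i, l))
      - (\<Sum>i<dim_row M. M $$ (i, j) * M $$ (i, l))\<bar>)" (is "_ \<le> _ + ?e")
proof (rule ric_le)
  have e0: "0 \<le> ?e" by (intro sum_nonneg) auto
  have R: "is_rip_bound s M (ric s M)" by (rule is_rip_bound_ric)
  show "is_rip_bound s M' (ric s M + ?e)"
    unfolding is_rip_bound_def
  proof (intro conjI ballI impI)
    show "0 \<le> ric s M + ?e" using e0 R by (simp add: is_rip_bound_def)
    fix x :: "real Matrix.vec" assume x: "x \<in> carrier_vec (dim_col M')" "vec_l0 x \<le> s"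
    have d: "dim_vec x = q" using x q by auto
    \<comment> \<open>Each product of two coordinates is thus at most the squared norm, so the
      entrywise sum \<open>?e\<close> controls the difference of the quadratic forms.\<close>
    have le: "\<bar>vec_index x j\<bar> \<le> vec_l2 x" if "j < q" for j
    proof -
      have "(vec_index x j)\<^sup>2 \<le> (vec_l2 x)\<^sup>2"
        using member_le_sum[of j "{..<q}" "\<lambda>i. (vec_index x i)\<^sup>2"] that d by (simp add: vec_l2_sq)
      then show ?thesis by (simp add: abs_le_square_iff[symmetric] vec_l2_def)
    qed
    have "\<bar>(vec_l2 (M' *\<^sub>v x))\<^sup>2 - (vec_l2 (M *\<^sub>v x))\<^sup>2\<bar>
       = \<bar>\<Sum>j<q. \<Sum>l<q. ((\<Sum>i<dim_row M'. M' $$ (i, j) * M' $$ (i, l))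
      - (\<Sum>i<dim_row M. M $$ (i, j) * M $$ (i, l))) * (vec_index x j * vec_index x l)\<bar>"
      using x q by (simp add: vec_l2_mult_gram sum_subtractf left_diff_distrib)
    also have "\<dots> \<le> (\<Sum>j<q. \<Sum>l<q. \<bar>((\<Sum>i<dim_row M'. M' $$ (i, j) * M' $$ (i, l))
      - (\<Sum>i<dim_row M. M $$ (i, j) * M $$ (i, l))) * (vec_index x j * vec_index x l)\<bar>)"
      by (rule order_trans[OF sum_abs sum_mono]) (rule sum_abs)
    also have "\<dots> \<le> (\<Sum>j<q. \<Sum>l<q. \<bar>(\<Sum>i<dim_row M'. M' $$ (i, j) * M' $$ (i, l))
      - (\<Sum>i<dim_row M. M $$ (i, j) * M $$ (i, l))\<bar> * (vec_l2 x)\<^sup>2)"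
      by (intro sum_mono) (auto simp: vec_l2_def abs_mult power2_eq_square intro!: mult_left_mono mult_mono le[unfolded vec_l2_def])
    finally have diff: "\<bar>(vec_l2 (M' *\<^sub>v x))\<^sup>2 - (vec_l2 (M *\<^sub>v x))\<^sup>2\<bar> \<le> ?e * (vec_l2 x)\<^sup>2"
      by (simp add: sum_distrib_right)
    have "(1 - ric s M) * (vec_l2 x)\<^sup>2 \<le> (vec_l2 (M *\<^sub>v x))\<^sup>2"
      "(vec_l2 (M *\<^sub>v x))\<^sup>2 \<le> (1 + ric s M) * (vec_l2 x)\<^sup>2"
      using R x q by (auto simp: is_rip_bound_def)
    with diff show "(1 - (ric s M + ?e)) * (vec_l2 x)\<^sup>2 \<le> (vec_l2 (M' *\<^sub>v x))\<^sup>2"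
      "(vec_l2 (M' *\<^sub>v x))\<^sup>2 \<le> (1 + (ric s M + ?e)) * (vec_l2 x)\<^sup>2"
      by (simp_all add: algebra_simps abs_le_iff)
  qed
qed

lemma ric_nonneg: "0 \<le> ric s M"
  using is_rip_bound_ric[of s M] by (simp add: is_rip_bound_def)

text \<open>Cauchy-Schwarz gives the upper inequality, and the summand 1 makes the factor in the
  lower one nonpositive. The bound is quadratic in the entries and serves as an integrable
  majorant.\<close>

lemma ric_le_frobenius:
  assumes "M \<in> carrier_mat p q"
  shows "ric s M \<le> 1 + (\<Sum>i<p. \<Sum>j<q. (M $$ (i, j))\<^sup>2)"
proof (rule ric_le, unfold is_rip_bound_def, intro conjI ballI impI)
  define c where "c = (\<Sum>i<p. \<Sum>j<q. (M $$ (i, j))\<^sup>2)"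
  have c0: "0 \<le> c" unfolding c_def by (intro sum_nonneg) auto
  then show "0 \<le> 1 + (\<Sum>i<p. \<Sum>j<q. (M $$ (i, j))\<^sup>2)" by (simp add: c_def)
  fix x :: "real Matrix.vec" assume x: "x \<in> carrier_vec (dim_col M)"
  have "(1 - (1 + c)) * (vec_l2 x)\<^sup>2 \<le> 0" using c0 by simp
  then show "(1 - (1 + (\<Sum>i<p. \<Sum>j<q. (M $$ (i, j))\<^sup>2))) * (vec_l2 x)\<^sup>2 \<le> (vec_l2 (M *\<^sub>v x))\<^sup>2"
    unfolding c_def by (rule order_trans) simp
  have "c * (vec_l2 x)\<^sup>2 \<le> (1 + (1 + c)) * (vec_l2 x)\<^sup>2" by (intro mult_right_mono) auto
  with mult_mat_vec_bound[OF x] assms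
  show "(vec_l2 (M *\<^sub>v x))\<^sup>2 \<le> (1 + (1 + (\<Sum>i<p. \<Sum>j<q. (M $$ (i, j))\<^sup>2))) * (vec_l2 x)\<^sup>2"
    unfolding c_def by auto
qed

section \<open>Continuity and Borel measurability of the constants\<close>

text \<open>The Gram entries are polynomials in the matrix entries. Hence the error term of
  \<open>ric_le_gram\<close>, applied in both directions, is continuous in \<open>x\<close> and
  vanishes at \<open>y\<close>.\<close>

lemma continuous_on_ric:
  fixes B :: "'a::topological_space \<Rightarrow> real mat"
  assumes B: "\<And>x. B x \<in> carrier_mat p q"
    and cont: "\<And>i j. i < p \<Longrightarrow> j < q \<Longrightarrow> continuous_on UNIV (\<lambda>x. B x $$ (i, j))"
  shows "continuous_on UNIV (\<lambda>x. ric s (B x))"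
proof -
  have dim: "dim_row (B x) = p" "dim_col (B x) = q" for x using B[of x] by auto
  have "((\<lambda>x. ric s (B x)) \<longlongrightarrow> ric s (B y)) (at y)" for y
  proof -
    define e where "e = (\<lambda>x. \<Sum>j<q. \<Sum>l<q. \<bar>(\<Sum>i<p. B x $$ (i, j) * B x $$ (i, l))
      - (\<Sum>i<p. B y $$ (i, j) * B y $$ (i, l))\<bar>)"
    have "continuous_on UNIV e"
      unfolding e_def by (intro continuous_intros cont) auto
    then have "(e \<longlongrightarrow> e y) (at y)" by (simp add: continuous_on_def)
    then have e: "(e \<longlongrightarrow> 0) (at y)" by (simp add: e_def)
    have "\<bar>ric s (B x) - ric s (B y)\<bar> \<le> e x" for x
      using ric_le_gram[OF dim(2) dim(2), of s x y] ric_le_gram[OF dim(2) dim(2), of s y x]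
      by (simp add: e_def dim abs_minus_commute abs_le_iff)
    then have "((\<lambda>x. ric s (B x) - ric s (B y)) \<longlongrightarrow> 0) (at y)"
      by (intro Lim_null_comparison[OF _ e]) simp
    then show ?thesis by (simp add: LIM_zero_iff)
  qed
  then show ?thesis by (simp add: continuous_on_def)
qed

lemma continuous_on_product_coordinate' [continuous_intros]:
  "continuous_on A (\<lambda>F :: 'i \<Rightarrow> real. F i)"
  using continuous_on_product_coordinates by (rule continuous_on_subset) simp

text \<open>A function of a random matrix is factored through the family of its entries, a point of
  a countable product of real lines, where measurability can be checked coordinatewise.\<close>

lemma borel_measurable_entries:
  fixes B :: "'w \<Rightarrow> real mat" and f :: "real mat \<Rightarrow> real"
  assumes f: "(\<lambda>F. f (mat p q F)) \<in> borel_measurable borel"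
    and B: "\<And>\<omega>. \<omega> \<in> space M \<Longrightarrow> B \<omega> \<in> carrier_mat p q"
    and meas: "\<And>i j. i < p \<Longrightarrow> j < q \<Longrightarrow> (\<lambda>\<omega>. B \<omega> $$ (i, j)) \<in> borel_measurable M"
  shows "(\<lambda>\<omega>. f (B \<omega>)) \<in> borel_measurable M"
proof -
  \<comment> \<open>Entries outside the index range are unspecified; the default 0 keeps these
    coordinates measurable.\<close>
  define F where "F = (\<lambda>\<omega> x. if fst x < p \<and> snd x < q then B \<omega> $$ x else 0)"
  have "F \<in> borel_measurable M"
  proof (rule measurable_coordinatewise_then_product)
    show "(\<lambda>\<omega>. F \<omega> x) \<in> borel_measurable M" for x
      using meas[of "fst x" "snd x"] by (cases "fst x < p \<and> snd x < q") (auto simp: F_def)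
  qed
  then have "(\<lambda>\<omega>. f (mat p q (F \<omega>))) \<in> borel_measurable M"
    using f by (rule measurable_compose)
  moreover have "mat p q (F \<omega>) = B \<omega>" if "\<omega> \<in> space M" for \<omega>
    using B[OF that] by (intro eq_matI) (auto simp: F_def)
  ultimately show ?thesis by (simp cong: measurable_cong)
qed

lemma borel_measurable_ric_mat: "(\<lambda>F. ric s (mat p q F)) \<in> borel_measurable borel"
proof (rule borel_measurable_continuous_onI, rule continuous_on_ric)
  show "continuous_on UNIV (\<lambda>F. mat p q F $$ (i, j))" if "i < p" "j < q" for i j
    using that by (simp add: continuous_intros)
qed auto

text \<open>Together with nonemptiness this makes the real-valued \<open>Inf\<close> in
  \<open>ric_opt\<close> a genuine infimum.\<close>

lemma bdd_below_ric_opt: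
  "bdd_below {ric s (W * \<Phi> * D) | W D. dim_col W = dim_row \<Phi> \<and>
     D \<in> carrier_mat (dim_col \<Phi>) (dim_col \<Phi>) \<and> diagonal_mat D \<and> invertible_mat D}"
  by (rule bdd_belowI[of _ 0]) (auto simp: ric_nonneg)

lemma nonempty_ric_opt:
  "{ric s (W * \<Phi> * D) | W D. dim_col W = dim_row \<Phi> \<and>
     D \<in> carrier_mat (dim_col \<Phi>) (dim_col \<Phi>) \<and> diagonal_mat D \<and> invertible_mat D} \<noteq> {}"
proof -
  have "diagonal_mat (1\<^sub>m (dim_col \<Phi>) :: real mat)" "invertible_mat (1\<^sub>m (dim_col \<Phi>) :: real mat)"
    by (auto simp: diagonal_mat_def invertible_mat_def inverts_mat_def intro!: exI[of _ "1\<^sub>m (dim_col \<Phi>)"])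
  then show ?thesis
    using one_carrier_mat[of "dim_col \<Phi>"] index_one_mat(3)[of "dim_row \<Phi>"] by blast
qed

lemma ric_opt_nonneg: "0 \<le> ric_opt s \<Phi>"
  unfolding ric_opt_def by (rule cInf_greatest[OF nonempty_ric_opt]) (auto simp: ric_nonneg)

lemma ric_opt_le:
  assumes "dim_col W = dim_row \<Phi>" "D \<in> carrier_mat (dim_col \<Phi>) (dim_col \<Phi>)"
    "diagonal_mat D" "invertible_mat D"
  shows "ric_opt s \<Phi> \<le> ric s (W * \<Phi> * D)"
  unfolding ric_opt_def by (rule cInf_lower[OF _ bdd_below_ric_opt]) (use assms in blast)

text \<open>The infimum ranges over uncountably many pairs, but an infimum of continuous functions is upper
  semicontinuous.\<close>

lemma borel_measurable_ric_opt_mat: "(\<lambda>F. ric_opt s (mat p q F)) \<in> borel_measurable borel"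
  unfolding borel_measurable_iff_less
proof
  fix a :: real
  let ?WD = "{(W, D). dim_col W = p \<and> D \<in> carrier_mat q q \<and> diagonal_mat D \<and> invertible_mat (D :: real mat)}"
  \<comment> \<open>The infimum is below \<open>a\<close> exactly when the constant of some
    admissible pair is. The sublevel set is therefore a union of open sets, which is open however
    many pairs there are.\<close>
  have "{F. ric_opt s (mat p q F) < a} = (\<Union>(W, D)\<in>?WD. {F. ric s (W * mat p q F * D) < a})"
    unfolding ric_opt_def cInf_less_iff[OF nonempty_ric_opt bdd_below_ric_opt] by auto
  also have "open \<dots>"
  proof (intro open_UN ballI, clarify)
    fix W D :: "real mat" assume WD: "D \<in> carrier_mat q q" "p = dim_col W"
    have "continuous_on UNIV (\<lambda>F. ric s (W * mat (dim_col W) q F * D))"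
    proof (rule continuous_on_ric)
      show "W * mat (dim_col W) q F * D \<in> carrier_mat (dim_row W) q" for F using WD by auto
      fix i j assume ij: "i < dim_row W" "j < q"
      have "(W * mat (dim_col W) q F * D) $$ (i, j)
          = (\<Sum>k<q. (\<Sum>l<dim_col W. W $$ (i, l) * F (l, k)) * D $$ (k, j))" for F
        using WD ij by (simp add: scalar_prod_def atLeast0LessThan)
      then show "continuous_on UNIV (\<lambda>F. (W * mat (dim_col W) q F * D) $$ (i, j))"
        by (simp add: continuous_intros)
    qed
    then show "open {F. ric s (W * mat (dim_col W) q F * D) < a}"
      by (intro open_Collect_less continuous_intros)
  qed
  finally show "{F \<in> space borel. ric_opt s (mat p q F) < a} \<in> sets borel" by simp
qed

section \<open>The left null space\<close>

lemma exists_orthogonal_vec: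
  fixes vs :: "real Matrix.vec list"
  assumes vs: "set vs \<subseteq> carrier_vec n" and len: "length vs < n"
  shows "\<exists>v \<in> carrier_vec n. v \<noteq> 0\<^sub>v n \<and> (\<forall>u\<in>set vs. scalar_prod u v = 0)"
proof -
  txt \<open>Padding with zero rows gives a singular square matrix.\<close>
  define c where "c = (\<lambda>i. if i < length vs then vs ! i else 0\<^sub>v n)"
  define A where "A = mat\<^sub>r n n c"
  \<comment> \<open>The last row is zero because \<open>length vs < n\<close>; rewriting
    \<open>c\<close> in this form matches \<open>det_row_0\<close>.\<close>
  have "c = (\<lambda>i. if i = n - 1 then 0\<^sub>v n else c i)" using len by (auto simp: c_def fun_eq_iff)
  moreover have c: "c \<in> {0..<n} \<rightarrow> carrier_vec n" using subsetD[OF vs nth_mem] by (auto simp: c_def)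
  ultimately have "det A = 0" using det_row_0[of "n - 1" n c] len by (simp add: A_def)
  then obtain v where v: "v \<in> carrier_vec n" "v \<noteq> 0\<^sub>v n" "A *\<^sub>v v = 0\<^sub>v n"
    using det_0_iff_vec_prod_zero_field[of A n] by (auto simp: A_def)
  have "scalar_prod (vs ! i) v = 0" if "i < length vs" for i
  proof -
    have "(A *\<^sub>v v) $ i = scalar_prod (row A i) v" using that len by (simp add: A_def)
    moreover have "row A i = vs ! i"
      using that len nth_mem[OF that] subsetD[OF vs] by (simp add: A_def c_def)
    ultimately show ?thesis using v that len by simp
  qed
  then show ?thesis using v by (intro bexI[of _ v]) (auto simp: in_set_conv_nth)
qed

text \<open>Vectors are added one at a time: as long as fewer than \<open>n\<close> have been
  listed, some nonzero vector is orthogonal to all of \<open>vs\<close> and to the earlier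
  \<open>ws\<close>, and scaling it to norm 1 keeps this.\<close>

lemma exists_orthonormal_complement:
  fixes vs :: "real Matrix.vec list"
  assumes vs: "set vs \<subseteq> carrier_vec n" and len: "length vs + t \<le> n"
  shows "\<exists>ws. length ws = t \<and> set ws \<subseteq> carrier_vec n \<and> (\<forall>u\<in>set vs. \<forall>w\<in>set ws. scalar_prod u w = 0) \<and>
    (\<forall>i<t. \<forall>j<t. scalar_prod (ws ! i) (ws ! j) = (if i = j then 1 else 0))"
  using len
proof (induction t)
  case (Suc t)
  then obtain ws where ws: "length ws = t" "set ws \<subseteq> carrier_vec n" "\<forall>u\<in>set vs. \<forall>w\<in>set ws. scalar_prod u w = 0"
    "\<forall>i<t. \<forall>j<t. scalar_prod (ws ! i) (ws ! j) = (if i = j then 1 else 0)" by auto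
  obtain v where v: "v \<in> carrier_vec n" "v \<noteq> 0\<^sub>v n" "\<forall>u\<in>set (vs @ ws). scalar_prod u v = 0"
    using exists_orthogonal_vec[of "vs @ ws" n] Suc.prems ws vs by auto
  define w where "w = (1 / sqrt (scalar_prod v v)) \<cdot>\<^sub>v v"
  have "scalar_prod v v > 0"
  proof -
    obtain i where i: "i < n" "v $ i \<noteq> 0" using v(1,2) by (metis carrier_vecD dim_vec index_zero_vec eq_vecI)
    have "scalar_prod v v = (\<Sum>i<n. (v $ i)\<^sup>2)"
      using v(1) by (simp add: scalar_prod_def atLeast0LessThan power2_eq_square)
    also have "\<dots> > 0" using i by (intro sum_pos2[of _ i]) auto
    finally show ?thesis .
  qed
  then have ww: "scalar_prod w w = 1" using v(1) by (simp add: w_def)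
  have w: "w \<in> carrier_vec n" using v by (simp add: w_def)
  have uw: "scalar_prod u w = 0" if "u \<in> set (vs @ ws)" for u
    using that v vs ws by (auto simp: w_def subset_iff)
  have wu: "scalar_prod w u = 0" if "u \<in> set ws" for u
    using uw[of u] that w ws comm_scalar_prod[of w n u] by auto
  show ?case
    using ws w uw wu ww
    by (intro exI[of _ "ws @ [w]"]) (auto simp: nth_append less_Suc_eq)
qed auto

text \<open>A maximal independent set of columns has \<open>r\<close> elements and spans all
  columns. Vectors orthogonal to these \<open>r\<close> are orthogonal to every column, and
  \<open>n - r\<close> orthonormal ones among them form the rows of \<open>W\<close>.\<close>

lemma exists_left_null_orthonormal:
  assumes \<Delta>: "\<Delta> \<in> carrier_mat n m" and r: "vec_space.rank n \<Delta> = r" "r \<le> n"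
  shows "\<exists>W. W \<in> carrier_mat (n - r) n \<and> W * \<Delta> = 0\<^sub>m (n - r) m \<and> W * W\<^sup>T = (1\<^sub>m (n - r) :: real mat)"
proof -
  interpret V: vec_space "TYPE(real)" n .
  obtain S where S: "maximal S (\<lambda>T. T \<subseteq> set (cols \<Delta>) \<and> V.lin_indpt T)" "finite S"
    using maximal_exists_superset[of "set (cols \<Delta>)" "\<lambda>T. T \<subseteq> set (cols \<Delta>) \<and> V.lin_indpt T" "{}"]
    by (auto simp: V.lin_dep_def)
  have cardS: "card S = r" using V.rank_card_indpt[OF \<Delta> S(1)] r by simp
  have colsV: "set (cols \<Delta>) \<subseteq> carrier_vec n" using cols_dim \<Delta> by blast
  have SV: "S \<subseteq> carrier_vec n" "V.lin_indpt S" using S(1) colsV by (auto simp: maximal_def)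
  \<comment> \<open>By maximality, adjoining a column outside \<open>S\<close> creates a dependence,
    which places that column in the span.\<close>
  have span: "v \<in> V.span S" if v: "v \<in> set (cols \<Delta>)" for v
  proof (cases "v \<in> S")
    case True
    then show ?thesis using V.span_mem[of S v] SV by simp
  next
    case False
    then have "V.lin_dep (S \<union> {v})" using S(1) v by (auto simp: maximal_def)
    then show ?thesis using V.lin_dep_iff_in_span[of S v] SV v colsV False by auto
  qed
  obtain vs where vs: "set vs = S" "length vs = r"
    using S(2) cardS by (metis distinct_card finite_distinct_list)
  obtain ws where ws: "length ws = n - r" "set ws \<subseteq> carrier_vec n" "\<forall>u\<in>S. \<forall>w\<in>set ws. scalar_prod u w = 0"
    "\<forall>i<n - r. \<forall>j<n - r. scalar_prod (ws ! i) (ws ! j) = (if i = j then 1 else 0)"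
    using exists_orthonormal_complement[of vs n "n - r"] vs SV r by auto
  have orth: "scalar_prod w v = 0" if w: "w \<in> set ws" and v: "v \<in> set (cols \<Delta>)" for w v
  proof -
    obtain a where a: "v = V.lincomb a S" using span[OF v] S(2) SV V.finite_in_span by blast
    have wc: "w \<in> carrier_vec n" using w ws by auto
    have "scalar_prod w v = (\<Sum>i<n. w $ i * (\<Sum>x\<in>S. a x * x $ i))"
      unfolding a using SV S(2) by (simp add: scalar_prod_def V.lincomb_index atLeast0LessThan V.lincomb_dim)
    also have "\<dots> = (\<Sum>x\<in>S. a x * (\<Sum>i<n. x $ i * w $ i))"
      by (simp add: sum_distrib_left mult_ac) (rule sum.swap)
    also have "\<dots> = (\<Sum>x\<in>S. a x * (scalar_prod x w))"
      using wc by (simp add: scalar_prod_def atLeast0LessThan)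
    also have "\<dots> = 0" using ws w by simp
    finally show ?thesis .
  qed
  have rows: "row (mat_of_rows n ws) i = ws ! i" if "i < n - r" for i
    using that ws by (simp add: subset_iff)
  show ?thesis
  proof (intro exI conjI)
    show "mat_of_rows n ws \<in> carrier_mat (n - r) n" using ws by auto
    show "mat_of_rows n ws * \<Delta> = 0\<^sub>m (n - r) m"
      using \<Delta> ws by (intro eq_matI) (auto simp: rows orth cols_def)
    show "mat_of_rows n ws * (mat_of_rows n ws)\<^sup>T = 1\<^sub>m (n - r)"
      using ws by (intro eq_matI) (auto simp: rows)
  qed
qed

section \<open>Gaussian matrices\<close>

text \<open>Positive dimensions make the index set nonempty, as required where independence is
  characterized by the product law. The standard deviation is left as a parameter.\<close>

locale gaussian_matrix = prob_space M for M :: "'w measure" +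
  fixes A :: "'w \<Rightarrow> real mat" and n m :: nat and \<sigma> :: real
  assumes \<sigma>: "0 < \<sigma>" and nm: "0 < n" "0 < m"
    and A: "\<And>\<omega>. \<omega> \<in> space M \<Longrightarrow> A \<omega> \<in> carrier_mat n m"
    and indep: "indep_vars (\<lambda>_. borel) (\<lambda>ij \<omega>. A \<omega> $$ ij) ({..<n} \<times> {..<m})"
    and normal: "\<And>i j. i < n \<Longrightarrow> j < m \<Longrightarrow>
      distributed M lborel (\<lambda>\<omega>. A \<omega> $$ (i, j)) (normal_density 0 \<sigma>)"

text \<open>Each entry of \<open>U * A \<omega>\<close> is a linear functional of the flattened
  family of entries of \<open>A \<omega>\<close>. Functionals for different columns have disjoint
  supports; within a column their inner products are the entries of \<open>U * U\<^sup>T\<close>. So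
  they are orthonormal.\<close>

lemma (in gaussian_matrix) distr_orthonormal_rows:
  assumes U: "U \<in> carrier_mat p n" "U * U\<^sup>T = 1\<^sub>m p"
  shows "(\<lambda>\<omega>. \<lambda>ij\<in>{..<p} \<times> {..<m}. (U * A \<omega>) $$ ij)
      \<in> M \<rightarrow>\<^sub>M PiM ({..<p} \<times> {..<m}) (\<lambda>_. gaussian \<sigma>)" (is "?Y \<in> _ \<rightarrow>\<^sub>M ?Q")
    and "distr M (PiM ({..<p} \<times> {..<m}) (\<lambda>_. gaussian \<sigma>))
      (\<lambda>\<omega>. \<lambda>ij\<in>{..<p} \<times> {..<m}. (U * A \<omega>) $$ ij) = PiM ({..<p} \<times> {..<m}) (\<lambda>_. gaussian \<sigma>)"
proof -
  let ?I = "{..<n} \<times> {..<m}" and ?J = "{..<p} \<times> {..<m}"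
  let ?P = "PiM ?I (\<lambda>_. gaussian \<sigma>)"
  let ?X = "\<lambda>\<omega>. \<lambda>ij\<in>?I. A \<omega> $$ ij"
  have rv: "random_variable borel (\<lambda>\<omega>. A \<omega> $$ ij)" if "ij \<in> ?I" for ij
    using that distributed_measurable[OF normal[of "fst ij" "snd ij"]] by auto
  have law: "distr M borel (\<lambda>\<omega>. A \<omega> $$ ij) = gaussian \<sigma>" if "ij \<in> ?I" for ij
  proof -
    obtain i j where ij: "ij = (i, j)" by (cases ij)
    have "distr M borel (\<lambda>\<omega>. A \<omega> $$ (i, j)) = distr M lborel (\<lambda>\<omega>. A \<omega> $$ (i, j))"
      by (rule distr_cong) auto
    then show ?thesis using normal[of i j] that ij by (simp add: distributed_distr_eq_density)
  qed
  have ne: "?I \<noteq> {}" using nm by auto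
  have X: "?X \<in> M \<rightarrow>\<^sub>M ?P" using rv by (intro measurable_restrict) simp
  \<comment> \<open>\<open>gaussian \<sigma>\<close> and \<open>borel\<close> have the same sets, so
    the joint law may be taken over \<open>borel\<close>, where independence identifies it with the
    product of the marginals.\<close>
  have "distr M ?P ?X = distr M (PiM ?I (\<lambda>_. borel)) ?X"
    by (intro distr_cong sets_PiM_cong) simp_all
  also have "\<dots> = PiM ?I (\<lambda>ij. distr M borel (\<lambda>\<omega>. A \<omega> $$ ij))"
    using indep_vars_iff_distr_eq_PiM'[OF ne rv] indep by simp
  also have "\<dots> = ?P" by (intro PiM_cong refl law)
  finally have distX: "distr M ?P ?X = ?P" .
  define u :: "nat \<times> nat \<Rightarrow> nat \<times> nat \<Rightarrow> real"
    where "u = (\<lambda>(i, j) (k, l). if l = j then U $$ (i, k) else 0)"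
  have UU: "(\<Sum>k<n. U $$ (i, k) * U $$ (i', k)) = (if i = i' then 1 else 0)" if "i < p" "i' < p" for i i'
  proof -
    have "(U * U\<^sup>T) $$ (i, i') = (\<Sum>k<n. U $$ (i, k) * U $$ (i', k))"
      using U(1) that by (simp add: scalar_prod_def atLeast0LessThan)
    then show ?thesis using U(2) that by simp
  qed
  have orth: "(\<Sum>kl\<in>?I. u a kl * u b kl) = (if a = b then 1 else 0)" if "a \<in> ?J" "b \<in> ?J" for a b
  proof -
    obtain i j i' j' where ab: "a = (i, j)" "b = (i', j')" by (cases a, cases b)
    \<comment> \<open>The test on \<open>l\<close> is placed outermost so that the sum over
      \<open>l\<close> collapses at \<open>l = j\<close>.\<close>
    have "(\<Sum>kl\<in>?I. u a kl * u b kl) = (\<Sum>k<n. \<Sum>l<m. if l = j then (if j = j' then U $$ (i, k) * U $$ (i', k) else 0) else 0)"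
      unfolding sum.cartesian_product by (intro sum.cong refl) (auto simp: u_def ab)
    also have "\<dots> = (\<Sum>k<n. if j = j' then U $$ (i, k) * U $$ (i', k) else 0)"
      using that ab by (simp add: sum.delta)
    also have "\<dots> = (if a = b then 1 else 0)"
      using UU[of i i'] that ab by (cases "j = j'") auto
    finally show ?thesis .
  qed
  let ?L = "\<lambda>x. \<lambda>ij\<in>?J. \<Sum>kl\<in>?I. u ij kl * x kl"
  have L: "?L \<in> ?P \<rightarrow>\<^sub>M ?Q" by (intro measurable_restrict) simp
  have LX: "?L (?X \<omega>) = ?Y \<omega>" if "\<omega> \<in> space M" for \<omega>
  proof (rule restrict_ext)
    fix ij assume ij: "ij \<in> ?J"
    obtain i j where [simp]: "ij = (i, j)" by (cases ij)
    have "(\<Sum>kl\<in>?I. u ij kl * ?X \<omega> kl) = (\<Sum>k<n. \<Sum>l<m. if l = j then U $$ (i, k) * A \<omega> $$ (k, l) else 0)"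
      unfolding sum.cartesian_product by (intro sum.cong refl) (auto simp: u_def)
    also have "\<dots> = (\<Sum>k<n. U $$ (i, k) * A \<omega> $$ (k, j))"
      using ij by (simp add: sum.delta)
    also have "\<dots> = (U * A \<omega>) $$ ij"
      using ij U(1) A[OF that] by (simp add: scalar_prod_def atLeast0LessThan)
    finally show "(\<Sum>kl\<in>?I. u ij kl * ?X \<omega> kl) = (U * A \<omega>) $$ ij" .
  qed
  have "(\<lambda>\<omega>. ?L (?X \<omega>)) \<in> M \<rightarrow>\<^sub>M ?Q" by (rule measurable_compose[OF X L])
  moreover have "(\<lambda>\<omega>. ?L (?X \<omega>)) \<in> M \<rightarrow>\<^sub>M ?Q \<longleftrightarrow> ?Y \<in> M \<rightarrow>\<^sub>M ?Q"
    by (rule measurable_cong) (rule LX)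
  ultimately show Y: "?Y \<in> M \<rightarrow>\<^sub>M ?Q" by blast
  have "distr M ?Q ?Y = distr M ?Q (\<lambda>\<omega>. ?L (?X \<omega>))"
    by (rule distr_cong[OF refl refl]) (simp only: LX)
  also have "\<dots> = distr (distr M ?P ?X) ?Q ?L"
    by (subst distr_distr[OF L X]) (simp add: comp_def)
  also have "\<dots> = ?Q"
    unfolding distX by (rule distr_gaussian_orthonormal[OF \<sigma> _ _ orth]) simp_all
  finally show "distr M ?Q ?Y = ?Q" .
qed

lemma borel_measurable_ric_PiM:
  "(\<lambda>F. ric s (mat p m F)) \<in> borel_measurable (PiM ({..<p} \<times> {..<m}) (\<lambda>_. gaussian \<sigma>))"
  by (rule borel_measurable_entries[OF borel_measurable_ric_mat, where B = "\<lambda>F. mat p m F"]) auto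

text \<open>The constant is dominated by the Frobenius bound, whose integrability is that of the
  second moments of the Gaussian marginals.\<close>

lemma integrable_ric_gaussian:
  assumes \<sigma>: "0 < \<sigma>"
  shows "integrable (PiM ({..<p} \<times> {..<m}) (\<lambda>_. gaussian \<sigma>)) (\<lambda>F. ric s (mat p m F))"
proof -
  let ?J = "{..<p} \<times> {..<m}"
  let ?Q = "PiM ?J (\<lambda>_. gaussian \<sigma>)"
  have N: "prob_space (gaussian \<sigma>)" by (rule prob_space_normal_density[OF \<sigma>])
  interpret Q: prob_space ?Q by (intro prob_space_PiM N)
  have sq: "integrable (gaussian \<sigma>) (\<lambda>x. x\<^sup>2)"
    using integrable_normal_moment[OF \<sigma>, of 0 2]
    by (subst integrable_density) (auto simp: normal_density_nonneg)
  have "integrable ?Q (\<lambda>F. (F ij)\<^sup>2)" if "ij \<in> ?J" for ij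
  proof -
    have "integrable (distr ?Q (gaussian \<sigma>) (\<lambda>F. F ij)) (\<lambda>x. x\<^sup>2)"
      using sq distr_PiM_component[of ?J "\<lambda>_. gaussian \<sigma>" ij, OF N that] by simp
    then show ?thesis using that by (subst (asm) integrable_distr_eq) auto
  qed
  then have "integrable ?Q (\<lambda>F. 1 + (\<Sum>i<p. \<Sum>j<m. (F (i, j))\<^sup>2))"
    by (intro Bochner_Integration.integrable_add Bochner_Integration.integrable_sum) auto
  then show ?thesis
  proof (rule Bochner_Integration.integrable_bound[OF _ borel_measurable_ric_PiM])
    have "ric s (mat p m F) \<le> 1 + (\<Sum>i<p. \<Sum>j<m. (F (i, j))\<^sup>2)" for F
      using ric_le_frobenius[of "mat p m F" p m s] by simp
    then show "AE F in ?Q. norm (ric s (mat p m F)) \<le> norm (1 + (\<Sum>i<p. \<Sum>j<m. (F (i, j))\<^sup>2))"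
      by (auto simp: ric_nonneg intro: order_trans[OF _ abs_ge_self])
  qed
qed

text \<open>The right-hand side depends on \<open>U\<close> only through its number of rows
  \<open>p\<close>. Any two matrices with \<open>p\<close> orthonormal rows therefore give the same
  expected constant.\<close>

lemma (in gaussian_matrix) ric_orthonormal_rows:
  assumes U: "U \<in> carrier_mat p n" "U * U\<^sup>T = 1\<^sub>m p"
  shows "integrable M (\<lambda>\<omega>. ric s (U * A \<omega>))"
    and "(\<integral>\<omega>. ric s (U * A \<omega>) \<partial>M)
      = (\<integral>F. ric s (mat p m F) \<partial>PiM ({..<p} \<times> {..<m}) (\<lambda>_. gaussian \<sigma>))"
proof -
  let ?Q = "PiM ({..<p} \<times> {..<m}) (\<lambda>_. gaussian \<sigma>)"
  let ?Y = "\<lambda>\<omega>. \<lambda>ij\<in>{..<p} \<times> {..<m}. (U * A \<omega>) $$ ij"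
  note Y = distr_orthonormal_rows[OF assms]
  have eq: "mat p m (?Y \<omega>) = U * A \<omega>" if "\<omega> \<in> space M" for \<omega>
    using A[OF that] U(1) by (intro eq_matI) auto
  have "integrable (distr M ?Q ?Y) (\<lambda>F. ric s (mat p m F))"
    unfolding Y(2) by (rule integrable_ric_gaussian[OF \<sigma>])
  then have "integrable M (\<lambda>\<omega>. ric s (mat p m (?Y \<omega>)))"
    by (subst (asm) integrable_distr_eq[OF Y(1) borel_measurable_ric_PiM])
  moreover have "integrable M (\<lambda>\<omega>. ric s (mat p m (?Y \<omega>))) \<longleftrightarrow> integrable M (\<lambda>\<omega>. ric s (U * A \<omega>))"
    by (rule Bochner_Integration.integrable_cong) (simp_all only: eq)
  ultimately show "integrable M (\<lambda>\<omega>. ric s (U * A \<omega>))" by blast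
  have "(\<integral>F. ric s (mat p m F) \<partial>?Q) = (\<integral>F. ric s (mat p m F) \<partial>distr M ?Q ?Y)"
    by (simp only: Y(2))
  also have "\<dots> = (\<integral>\<omega>. ric s (mat p m (?Y \<omega>)) \<partial>M)"
    by (rule integral_distr[OF Y(1) borel_measurable_ric_PiM])
  also have "\<dots> = (\<integral>\<omega>. ric s (U * A \<omega>) \<partial>M)"
    by (rule Bochner_Integration.integral_cong) (auto simp: eq)
  finally show "(\<integral>\<omega>. ric s (U * A \<omega>) \<partial>M) = (\<integral>F. ric s (mat p m F) \<partial>?Q)" ..
qed

section \<open>Row removal, column normalization and the pointwise bound\<close>

text \<open>The rows of \<open>P\<close> are the unit vectors at the indices that are kept, listed
  in order by \<open>pick\<close>; distinct indices make them orthonormal.\<close>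

lemma remove_rows_eq_mult:
  assumes "R \<subseteq> {..<n}"
  obtains P :: "real mat" where "P \<in> carrier_mat (n - card R) n" "P * P\<^sup>T = 1\<^sub>m (n - card R)"
    "\<And>B m. B \<in> carrier_mat n m \<Longrightarrow> remove_rows R B = P * B"
proof
  define p where "p = n - card R"
  define P :: "real mat" where "P = mat p n (\<lambda>(i, k). if k = pick (- R) i then 1 else 0)"
  have "{i. i < n \<and> i \<in> - R} = {..<n} - R" by auto
  then have card: "card {i. i < n \<and> i \<in> - R} = p"
    using assms by (simp add: p_def card_Diff_subset finite_subset)
  have lt: "pick (- R) i < n" if "i < p" for i using pick_le[of i n "- R"] that card by simp
  \<comment> \<open>The complement is taken in all natural numbers. Being infinite, it makes
    \<open>pick\<close> injective without any bound on the position.\<close>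
  have inf: "infinite (- R)" using assms finite_subset[OF assms] by (simp add: Compl_eq_Diff_UNIV)
  show "P \<in> carrier_mat (n - card R) n" by (simp add: P_def p_def)
  show "P * P\<^sup>T = 1\<^sub>m (n - card R)"
  proof (rule eq_matI)
    fix i j assume "i < dim_row (1\<^sub>m (n - card R) :: real mat)" "j < dim_col (1\<^sub>m (n - card R) :: real mat)"
    then have ij: "i < p" "j < p" by (simp_all add: p_def)
    have "(P * P\<^sup>T) $$ (i, j) = (\<Sum>k<n. P $$ (i, k) * P $$ (j, k))"
      using ij by (simp add: P_def scalar_prod_def atLeast0LessThan)
    also have "\<dots> = (\<Sum>k<n. if k = pick (- R) i then (if k = pick (- R) j then 1 else 0) else 0)"
      using ij by (intro sum.cong refl) (simp add: P_def)
    also have "\<dots> = (if pick (- R) i = pick (- R) j then 1 else 0)"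
      using lt[OF ij(1)] by (simp add: sum.delta)
    also have "\<dots> = 1\<^sub>m (n - card R) $$ (i, j)"
      using ij pick_eq_iff_inf[OF inf, of i j] by (simp add: p_def)
    finally show "(P * P\<^sup>T) $$ (i, j) = 1\<^sub>m (n - card R) $$ (i, j)" .
  qed (simp_all add: P_def p_def)
  fix B :: "real mat" and m assume B: "B \<in> carrier_mat n m"
  show "remove_rows R B = P * B"
  proof (rule eq_matI)
    fix i j assume "i < dim_row (P * B)" "j < dim_col (P * B)"
    then have ij: "i < p" "j < m" using B by (simp_all add: P_def)
    have "(P * B) $$ (i, j) = (\<Sum>k<n. P $$ (i, k) * B $$ (k, j))"
      using ij B by (simp add: P_def scalar_prod_def atLeast0LessThan)
    also have "\<dots> = (\<Sum>k<n. if k = pick (- R) i then B $$ (k, j) else 0)"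
      using ij by (intro sum.cong refl) (simp add: P_def)
    also have "\<dots> = B $$ (pick (- R) i, j)" using lt[OF ij(1)] by (simp add: sum.delta)
    finally show "remove_rows R B $$ (i, j) = (P * B) $$ (i, j)"
      using ij B card unfolding remove_rows_def by (subst submatrix_index) (auto simp: pick_UNIV)
  qed (use B card in \<open>simp_all add: remove_rows_def dim_submatrix P_def\<close>)
qed

text \<open>The pair \<open>(1 / \<epsilon>) \<cdot>\<^sub>m W\<close> and \<open>D\<close> is
  admissible in the infimum: \<open>D\<close> restores the column lengths, \<open>W\<close>
  annihilates \<open>\<Delta>\<close>, and the scalar factors cancel.\<close>

lemma ric_opt_normalize_cols_le:
  fixes A \<Delta> W :: "real mat"
  assumes A: "A \<in> carrier_mat n m" and \<Delta>: "\<Delta> \<in> carrier_mat n m" and \<epsilon>: "\<epsilon> \<noteq> 0"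
    and W: "W \<in> carrier_mat p n" "W * \<Delta> = 0\<^sub>m p m"
  shows "ric_opt s (normalize_cols (\<epsilon> \<cdot>\<^sub>m A + \<Delta>)) \<le> ric s (W * A)"
proof -
  define B where "B = \<epsilon> \<cdot>\<^sub>m A + \<Delta>"
  have B: "B \<in> carrier_mat n m" using A \<Delta> by (simp add: B_def)
  txt \<open>A zero column of \<open>B\<close> survives normalization unchanged, so any nonzero factor undoes it.\<close>
  define d where "d = (\<lambda>j. if vec_l2 (col B j) = 0 then 1 else vec_l2 (col B j))"
  define D where "D = mat_diag m d"
  have d: "d j \<noteq> 0" for j by (simp add: d_def)
  have D: "D \<in> carrier_mat m m" "diagonal_mat D" by (auto simp: D_def diagonal_mat_def mat_diag_def)
  have dim: "dim_row (mat_diag m f) = m" for f :: "nat \<Rightarrow> real" by (simp add: mat_diag_def)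
  have "inverts_mat D (mat_diag m (\<lambda>j. 1 / d j))" "inverts_mat (mat_diag m (\<lambda>j. 1 / d j)) D"
    by (simp_all add: inverts_mat_def D_def dim d)
  then have invD: "invertible_mat D" using D(1) unfolding invertible_mat_def by auto
  have \<Phi>: "normalize_cols B \<in> carrier_mat n m"
    using B by (simp add: normalize_cols_def col_scaling_def)
  have scale: "normalize_cols B * D = B"
  proof (rule eq_matI)
    fix i j assume "i < dim_row B" "j < dim_col B"
    then have ij: "i < n" "j < m" using B by auto
    have "B $$ (i, j) = 0" if "vec_l2 (col B j) = 0"
    proof -
      have "(\<Sum>k<n. (B $$ (k, j))\<^sup>2) = (vec_l2 (col B j))\<^sup>2"
        using B ij by (simp add: vec_l2_sq)
      then have "(\<Sum>k<n. (B $$ (k, j))\<^sup>2) = 0" using that by simp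
      then show ?thesis using ij by (subst (asm) sum_nonneg_eq_0_iff) auto
    qed
    moreover have "(normalize_cols B * D) $$ (i, j) = B $$ (i, j) * (1 / vec_l2 (col B j)) * d j"
      using B ij unfolding normalize_cols_def col_scaling_def D_def
      by (simp add: mat_diag_mult_right[of _ n m])
    ultimately show "(normalize_cols B * D) $$ (i, j) = B $$ (i, j)"
      by (simp add: d_def)
  qed (use B \<Phi> D in auto)
  have "(1 / \<epsilon>) \<cdot>\<^sub>m W * normalize_cols B * D = (1 / \<epsilon>) \<cdot>\<^sub>m W * (normalize_cols B * D)"
    using \<Phi> D W by (intro assoc_mult_mat) auto
  also have "\<dots> = (1 / \<epsilon>) \<cdot>\<^sub>m (W * B)" unfolding scale by (rule mult_smult_assoc_mat[OF W(1) B])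
  also have "W * B = W * (\<epsilon> \<cdot>\<^sub>m A) + W * \<Delta>"
    unfolding B_def using A \<Delta> W by (intro mult_add_distrib_mat) auto
  also have "\<dots> = \<epsilon> \<cdot>\<^sub>m (W * A)"
    using A W by (simp add: mult_smult_distrib[of W p n A m])
  also have "(1 / \<epsilon>) \<cdot>\<^sub>m \<dots> = W * A" using \<epsilon> by (intro eq_matI) auto
  finally have "(1 / \<epsilon>) \<cdot>\<^sub>m W * normalize_cols B * D = W * A" .
  moreover have "ric_opt s (normalize_cols B) \<le> ric s ((1 / \<epsilon>) \<cdot>\<^sub>m W * normalize_cols B * D)"
    using \<Phi> W D invD by (intro ric_opt_le) auto
  ultimately show ?thesis by (simp add: B_def)
qed

text \<open>The normalized entries are quotients of entries by column norms. Total real division is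
  Borel measurable, so zero columns are covered as well.\<close>

lemma borel_measurable_ric_opt_normalize_cols:
  fixes B :: "'w \<Rightarrow> real mat"
  assumes B: "\<And>\<omega>. \<omega> \<in> space M \<Longrightarrow> B \<omega> \<in> carrier_mat n m"
    and meas: "\<And>i j. i < n \<Longrightarrow> j < m \<Longrightarrow> (\<lambda>\<omega>. B \<omega> $$ (i, j)) \<in> borel_measurable M"
  shows "(\<lambda>\<omega>. ric_opt s (normalize_cols (B \<omega>))) \<in> borel_measurable M"
proof (rule borel_measurable_entries[OF borel_measurable_ric_opt_mat])
  show "normalize_cols (B \<omega>) \<in> carrier_mat n m" if "\<omega> \<in> space M" for \<omega>
    using B[OF that] by (simp add: normalize_cols_def col_scaling_def)
  fix i j assume ij: "i < n" "j < m"
  have [measurable]: "(\<lambda>\<omega>. B \<omega> $$ (k, j)) \<in> borel_measurable M" if "k < n" for k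
    using meas that ij by simp
  have "(\<lambda>\<omega>. B \<omega> $$ (i, j) * (1 / sqrt (\<Sum>k<n. (B \<omega> $$ (k, j))\<^sup>2))) \<in> borel_measurable M"
    using ij by measurable
  moreover have "normalize_cols (B \<omega>) $$ (i, j) = B \<omega> $$ (i, j) * (1 / sqrt (\<Sum>k<n. (B \<omega> $$ (k, j))\<^sup>2))"
    if "\<omega> \<in> space M" for \<omega>
    using B[OF that] ij unfolding normalize_cols_def col_scaling_def
    by (simp add: mat_diag_mult_right[of _ n m] vec_l2_def L2_set_def)
  ultimately show "(\<lambda>\<omega>. normalize_cols (B \<omega>) $$ (i, j)) \<in> borel_measurable M"
    by (simp cong: measurable_cong)
qed

text \<open>Integrability of both constants belongs to the conclusion because the Bochner integral
  of a non-integrable function is 0, which would leave the bare inequality without its intended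
  meaning.\<close>

theorem corollary4:
  fixes M :: "'w measure" and A :: "'w \<Rightarrow> real mat" and \<Delta> :: "real mat"
    and n m k r :: nat and \<epsilon> :: real and R :: "nat set"
  assumes "prob_space M"
    and "n < m" and "0 < k" and "0 < \<epsilon>"
    and "\<And>\<omega>. \<omega> \<in> space M \<Longrightarrow> A \<omega> \<in> carrier_mat n m"
    and "prob_space.indep_vars M (\<lambda>_. borel) (\<lambda>ij \<omega>. A \<omega> $$ ij) ({..<n} \<times> {..<m})"
    and "\<And>i j. i < n \<Longrightarrow> j < m \<Longrightarrow>
      distributed M lborel (\<lambda>\<omega>. A \<omega> $$ (i, j)) (normal_density 0 (1 / sqrt (real n)))"
    and "\<Delta> \<in> carrier_mat n m" and "vec_space.rank n \<Delta> = r" and "r < n"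
    and "R \<subseteq> {..<n}" and "card R = r"
  shows "integrable M (\<lambda>\<omega>. ric_opt (3 * k) (normalize_cols (\<epsilon> \<cdot>\<^sub>m A \<omega> + \<Delta>))) \<and>
    integrable M (\<lambda>\<omega>. ric (3 * k) (remove_rows R (A \<omega>))) \<and>
    prob_space.expectation M (\<lambda>\<omega>. ric_opt (3 * k) (normalize_cols (\<epsilon> \<cdot>\<^sub>m A \<omega> + \<Delta>)))
      \<le> prob_space.expectation M (\<lambda>\<omega>. ric (3 * k) (remove_rows R (A \<omega>)))"
proof -
  note \<Delta> = assms(8) and A = assms(5)
  have pos: "0 < 1 / sqrt (real n)" "0 < n" "0 < m" using assms(2,10) by auto
  obtain W :: "real mat" where W: "W \<in> carrier_mat (n - r) n" "W * \<Delta> = 0\<^sub>m (n - r) m" "W * W\<^sup>T = 1\<^sub>m (n - r)"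
    using exists_left_null_orthonormal[OF \<Delta> assms(9)] assms(10) by auto
  obtain P :: "real mat" where P: "P \<in> carrier_mat (n - r) n" "P * P\<^sup>T = 1\<^sub>m (n - r)"
    "\<And>B m. B \<in> carrier_mat n m \<Longrightarrow> remove_rows R B = P * B"
    using remove_rows_eq_mult[OF assms(11)] assms(12) by metis
  interpret gaussian_matrix M A n m "1 / sqrt (real n)"
    using assms(1) pos A assms(6,7) by (simp add: gaussian_matrix_def gaussian_matrix_axioms_def)
  note law = ric_orthonormal_rows[where s = "3 * k"]
  have intP: "integrable M (\<lambda>\<omega>. ric (3 * k) (remove_rows R (A \<omega>)))"
  proof -
    have "integrable M (\<lambda>\<omega>. ric (3 * k) (P * A \<omega>)) \<longleftrightarrow> integrable M (\<lambda>\<omega>. ric (3 * k) (remove_rows R (A \<omega>)))"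
      by (rule Bochner_Integration.integrable_cong) (simp_all add: P(3)[OF A])
    then show ?thesis using law(1)[OF P(1,2)] by blast
  qed
  have le: "ric_opt (3 * k) (normalize_cols (\<epsilon> \<cdot>\<^sub>m A \<omega> + \<Delta>)) \<le> ric (3 * k) (W * A \<omega>)"
    if "\<omega> \<in> space M" for \<omega>
    using A[OF that] \<Delta> W assms(4) by (intro ric_opt_normalize_cols_le) auto
  have intW: "integrable M (\<lambda>\<omega>. ric (3 * k) (W * A \<omega>))" by (rule law(1)[OF W(1,3)])
  \<comment> \<open>The optimal constant lies between 0 and the integrable constant of
    \<open>W * A \<omega>\<close>.\<close>
  have intO: "integrable M (\<lambda>\<omega>. ric_opt (3 * k) (normalize_cols (\<epsilon> \<cdot>\<^sub>m A \<omega> + \<Delta>)))"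
  proof (rule Bochner_Integration.integrable_bound[OF intW borel_measurable_ric_opt_normalize_cols])
    show "\<epsilon> \<cdot>\<^sub>m A \<omega> + \<Delta> \<in> carrier_mat n m" if "\<omega> \<in> space M" for \<omega> using A[OF that] \<Delta> by simp
    fix i j assume ij: "i < n" "j < m"
    have "(\<lambda>\<omega>. A \<omega> $$ (i, j)) \<in> borel_measurable M"
      using assms(7)[OF ij] by (auto dest: distributed_measurable)
    then have "(\<lambda>\<omega>. \<epsilon> * A \<omega> $$ (i, j) + \<Delta> $$ (i, j)) \<in> borel_measurable M" by measurable
    moreover have "(\<epsilon> \<cdot>\<^sub>m A \<omega> + \<Delta>) $$ (i, j) = \<epsilon> * A \<omega> $$ (i, j) + \<Delta> $$ (i, j)" if "\<omega> \<in> space M" for \<omega>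
      using A[OF that] \<Delta> ij by auto
    ultimately show "(\<lambda>\<omega>. (\<epsilon> \<cdot>\<^sub>m A \<omega> + \<Delta>) $$ (i, j)) \<in> borel_measurable M"
      by (simp cong: measurable_cong)
  next
    show "AE \<omega> in M. norm (ric_opt (3 * k) (normalize_cols (\<epsilon> \<cdot>\<^sub>m A \<omega> + \<Delta>))) \<le> norm (ric (3 * k) (W * A \<omega>))"
      using le by (intro AE_I2) (simp add: ric_opt_nonneg ric_nonneg)
  qed
  have "(\<integral>\<omega>. ric_opt (3 * k) (normalize_cols (\<epsilon> \<cdot>\<^sub>m A \<omega> + \<Delta>)) \<partial>M) \<le> (\<integral>\<omega>. ric (3 * k) (W * A \<omega>) \<partial>M)"
    by (rule integral_mono[OF intO intW le])
  \<comment> \<open>\<open>W\<close> and \<open>P\<close> both have \<open>n - r\<close> orthonormal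
    rows, so both expectations equal the same Gaussian integral.\<close>
  also have "\<dots> = (\<integral>\<omega>. ric (3 * k) (P * A \<omega>) \<partial>M)"
    using law(2)[OF W(1,3)] law(2)[OF P(1,2)] by simp
  also have "\<dots> = (\<integral>\<omega>. ric (3 * k) (remove_rows R (A \<omega>)) \<partial>M)"
    by (rule Bochner_Integration.integral_cong) (auto simp: P(3)[OF A])
  finally show ?thesis using intO intP by simp
qed

end
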